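(* For all positive integers $k,n$, it holds that $$s_{k,n} = a_{k,(n-1)k}.$$
   Context: A finite nonempty set $F\subset\mathbb{N}$ is called Schreier if $\min F\ge |F|$. For $k,n\in\mathbb{N}$, let $s_{k,n}$ be the number of sets $F\subset\{k,2k,\ldots,nk\}$ such that $F$ is Schreier and $nk\in F$. For $k\ge 1$, define the sequence $(a_{k,n})_{n=0}^\infty$ by $a_{k,0}=a_{k,1}=1$, $a_{k,2}=\cdots=a_{k,k}=2$, and $a_{k,n}=a_{k,n-k}+a_{k,n-k-1}$ for $n\ge k+1$. *)

theory Defs
  imports Main
begin

definition schreier :: "nat set \<Rightarrow> bool" where
  "schreier F \<longleftrightarrow> finite F \<and> F \<noteq> {} \<and> Min F \<ge> card F"

definition schreier_count :: "nat \<Rightarrow> nat \<Rightarrow> nat" where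
  "schreier_count k n = card {F. F \<subseteq> (\<lambda>i. i * k) ` {1..n} \<and> schreier F \<and> n * k \<in> F}"

text \<open>The sequence is only meant for \<open>k \<ge> 1\<close>; the value at \<open>k = 0\<close> is a dummy
  that makes the recursion terminate.\<close>

function schreier_seq :: "nat \<Rightarrow> nat \<Rightarrow> nat" where
  "schreier_seq k n =
    (if k = 0 then 0
     else if n \<le> 1 then 1
     else if n \<le> k then 2
     else schreier_seq k (n - k) + schreier_seq k (n - k - 1))"
  by pat_completeness auto
termination
  by (relation "measure snd") auto

text \<open>The defining equation would loop as a rewrite rule.\<close>

declare schreier_seq.simps [simp del]

end

theory Submission
  imports Defs
begin

text \<open>After dividing by \<open>k\<close>, the sets being counted are the \<open>F \<subseteq> {1..n}\<close> with \<open>n \<in> F\<close> and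
  \<open>card F \<le> k * Min F\<close>. Relax the problem to \<open>card F + c \<le> k * Min F\<close> for a slack \<open>c\<close>. According
  to whether \<open>n - 1 \<in> F\<close>, either delete \<open>n\<close> (which raises the slack by one) or replace \<open>n\<close> by
  \<open>n - 1\<close>; hence the count for \<open>(n, c)\<close> is the sum of those for \<open>(n - 1, c)\<close> and \<open>(n - 1, c + 1)\<close>.
  With the index \<open>(n - 1) * k - c\<close> this is exactly the recurrence of the sequence.\<close>

definition slack_sets :: "nat \<Rightarrow> nat \<Rightarrow> nat \<Rightarrow> nat set set" where
  "slack_sets k c n = {F. F \<subseteq> {1..n} \<and> n \<in> F \<and> (\<forall>x\<in>F. card F + c \<le> k * x)}"

lemma finite_slack_sets: "finite (slack_sets k c n)"
  by (rule finite_subset[of _ "Pow {1..n}"]) (auto simp: slack_sets_def)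

lemma slack_sets_finite: "F \<in> slack_sets k c n \<Longrightarrow> finite F"
  unfolding slack_sets_def using finite_subset[of F "{1..n}"] by auto

lemma card_ge_2I: "finite F \<Longrightarrow> x \<in> F \<Longrightarrow> y \<in> F \<Longrightarrow> x \<noteq> y \<Longrightarrow> 2 \<le> card F"
  using card_mono[of F "{x, y}"] by simp

text \<open>A second element besides \<open>Suc n\<close> forces \<open>card F\<close> to be at
  least 2, so the slack condition at \<open>x\<close> becomes \<open>c + 2 \<le> k * x\<close>. This
  lower bound on \<open>x\<close> settles both base cases.\<close>

lemma slack_sets_other_element:
  assumes "F \<in> slack_sets k c (Suc n)" and "x \<in> F" and "x \<noteq> Suc n"
  shows "1 \<le> x" and "x \<le> n" and "c + 2 \<le> k * x"
proof -
  have F: "F \<subseteq> {1..Suc n}" "Suc n \<in> F" "card F + c \<le> k * x"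
    using assms by (auto simp: slack_sets_def)
  show "1 \<le> x" "x \<le> n"
    using F(1) assms(2,3) by (auto simp: le_Suc_eq subset_iff)
  show "c + 2 \<le> k * x"
    using card_ge_2I[OF slack_sets_finite[OF assms(1)] assms(2) F(2) assms(3)] F(3) by simp
qed

lemma singleton_in_slack_sets: "c < k * Suc n \<Longrightarrow> {Suc n} \<in> slack_sets k c (Suc n)"
  by (simp add: slack_sets_def)

text \<open>Base case for index \<open>n * k - c\<close> equal to 0 or 1, where the sequence is 1: a
  further element \<open>x \<le> n\<close> would give
  \<open>c + 2 \<le> k * x \<le> n * k \<le> c + 1\<close>.\<close>

lemma slack_sets_eq_singleton:
  assumes "k \<ge> 1" and "c \<le> n * k" and "n * k \<le> c + 1"
  shows "slack_sets k c (Suc n) = {{Suc n}}"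
proof -
  have "F = {Suc n}" if F: "F \<in> slack_sets k c (Suc n)" for F
  proof -
    have "x = Suc n" if "x \<in> F" for x
    proof (rule ccontr)
      assume "x \<noteq> Suc n"
      note x = slack_sets_other_element[OF F that this]
      have "k * x \<le> k * n" using x(2) by simp
      then show False using x(3) assms(3) mult.commute[of n k] by linarith
    qed
    then show ?thesis using F by (auto simp: slack_sets_def)
  qed
  moreover have "c < k * Suc n" using assms by (simp add: mult.commute)
  ultimately show ?thesis using singleton_in_slack_sets by blast
qed

text \<open>Base case for index between 2 and \<open>k\<close>, where the sequence is 2: an element
  \<open>x < n\<close> would give \<open>c + 2 \<le> k * x \<le> n * k - k \<le> c\<close>, while
  \<open>c + 2 \<le> n * k\<close> is just what the two-element set requires at
  \<open>n\<close>.\<close>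

lemma slack_sets_eq_pair:
  assumes "c + 2 \<le> n * k" and "n * k \<le> c + k"
  shows "slack_sets k c (Suc n) = {{Suc n}, {n, Suc n}}"
proof -
  have n: "n \<ge> 1" using assms(1) by (cases n) auto
  have "F = {Suc n} \<or> F = {n, Suc n}" if F: "F \<in> slack_sets k c (Suc n)" for F
  proof -
    have "x = n \<or> x = Suc n" if "x \<in> F" for x
    proof (rule ccontr)
      assume "\<not> (x = n \<or> x = Suc n)"
      then have "x \<noteq> Suc n" "x \<noteq> n" by auto
      note x = slack_sets_other_element[OF F that this(1)]
      have "k * Suc x \<le> k * n" using x(2) \<open>x \<noteq> n\<close> by (intro mult_le_mono2) simp
      then show False using x(3) assms(2) by (simp add: mult.commute)
    qed
    then show ?thesis using F by (auto simp: slack_sets_def)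
  qed
  moreover have "{Suc n} \<in> slack_sets k c (Suc n)"
    using assms(1) by (intro singleton_in_slack_sets) (simp add: mult.commute)
  moreover have "{n, Suc n} \<in> slack_sets k c (Suc n)"
    using assms(1) n by (auto simp: slack_sets_def mult.commute)
  ultimately show ?thesis by blast
qed

text \<open>Deleting \<open>Suc n\<close> lowers the cardinality by one while the slack rises by
  one, so their sum, and with it the bound on every remaining element, is unchanged.\<close>

lemma card_slack_sets_with_pred:
  assumes "n \<ge> 1"
  shows "card {F \<in> slack_sets k c (Suc n). n \<in> F} = card (slack_sets k (Suc c) n)"
proof (rule bij_betw_same_card[OF bij_betw_byWitness[where
        f = "\<lambda>F. F - {Suc n}" and f' = "insert (Suc n)"]])
  show "\<forall>F\<in>{F \<in> slack_sets k c (Suc n). n \<in> F}. insert (Suc n) (F - {Suc n}) = F"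
    by (auto simp: slack_sets_def)
  show "\<forall>G\<in>slack_sets k (Suc c) n. insert (Suc n) G - {Suc n} = G"
    by (auto simp: slack_sets_def)
  show "(\<lambda>F. F - {Suc n}) ` {F \<in> slack_sets k c (Suc n). n \<in> F} \<subseteq> slack_sets k (Suc c) n"
  proof (clarify)
    fix F assume F: "F \<in> slack_sets k c (Suc n)" "n \<in> F"
    have "card F = Suc (card (F - {Suc n}))"
      using F slack_sets_finite[OF F(1)] by (intro card.remove) (auto simp: slack_sets_def)
    then show "F - {Suc n} \<in> slack_sets k (Suc c) n"
      using F by (auto simp: slack_sets_def le_Suc_eq subset_iff)
  qed
  show "insert (Suc n) ` slack_sets k (Suc c) n \<subseteq> {F \<in> slack_sets k c (Suc n). n \<in> F}"
  proof (clarify)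
    fix G assume G: "G \<in> slack_sets k (Suc c) n"
    then have G': "G \<subseteq> {1..n}" "n \<in> G" "\<forall>x\<in>G. card G + Suc c \<le> k * x"
      by (auto simp: slack_sets_def)
    have card: "card (insert (Suc n) G) = Suc (card G)"
      using G' slack_sets_finite[OF G] by (intro card_insert_disjoint) auto
    \<comment> \<open>The only new inequality is the one at the added element; it follows from the
      one at \<open>n\<close>, which lies in \<open>G\<close>.\<close>
    have "card G + Suc c \<le> k * Suc n"
      using G'(2,3) by (auto intro: le_trans[of _ "k * n"])
    then have "\<forall>x\<in>insert (Suc n) G. card (insert (Suc n) G) + c \<le> k * x"
      unfolding card using G'(3) by simp
    moreover have "insert (Suc n) G \<subseteq> {1..Suc n}" using G'(1) by fastforce
    ultimately show "insert (Suc n) G \<in> slack_sets k c (Suc n) \<and> n \<in> insert (Suc n) G"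
      using G'(2) unfolding slack_sets_def by blast
  qed
qed

text \<open>The hypothesis makes \<open>{n}\<close>, the image of \<open>{n + 1}\<close>, admissible.\<close>

lemma card_slack_sets_without_pred:
  assumes "c < n * k"
  shows "card {F \<in> slack_sets k c (Suc n). n \<notin> F} = card (slack_sets k c n)"
proof (rule bij_betw_same_card[OF bij_betw_byWitness[where
        f = "\<lambda>F. insert n (F - {Suc n})" and f' = "\<lambda>G. insert (Suc n) (G - {n})"]])
  have n: "n \<ge> 1" using assms by (cases n) auto
  show "\<forall>F\<in>{F \<in> slack_sets k c (Suc n). n \<notin> F}.
      insert (Suc n) (insert n (F - {Suc n}) - {n}) = F"
    by (auto simp: slack_sets_def)
  show "\<forall>G\<in>slack_sets k c n. insert n (insert (Suc n) (G - {n}) - {Suc n}) = G"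
    by (auto simp: slack_sets_def)
  show "(\<lambda>F. insert n (F - {Suc n})) ` {F \<in> slack_sets k c (Suc n). n \<notin> F} \<subseteq> slack_sets k c n"
  proof (clarify)
    fix F assume F: "F \<in> slack_sets k c (Suc n)" "n \<notin> F"
    let ?G = "insert n (F - {Suc n})"
    have fin: "finite F" using slack_sets_finite[OF F(1)] .
    have "card ?G = Suc (card (F - {Suc n}))"
      using F(2) fin by (intro card_insert_disjoint) auto
    also have "\<dots> = card F"
      using F(1) fin by (intro card_Suc_Diff1) (simp_all add: slack_sets_def)
    finally have card: "card ?G = card F" .
    \<comment> \<open>This is the bound at the new element \<open>n\<close>. Any other element
      \<open>x \<le> n\<close> of \<open>F\<close> passes its bound on to \<open>n\<close>; for a
      singleton the bound is \<open>1 + c \<le> k * n\<close>, that is, the hypothesis.\<close>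
    have "card F + c \<le> k * n"
    proof (cases "F = {Suc n}")
      case True
      then show ?thesis using assms by (simp add: mult.commute)
    next
      case False
      then obtain x where "x \<in> F" "x \<noteq> Suc n" using F by (auto simp: slack_sets_def)
      moreover from this have "card F + c \<le> k * x" "x \<le> n"
        using F slack_sets_other_element(2)[OF F(1)] by (auto simp: slack_sets_def)
      ultimately show ?thesis by (meson le_trans mult_le_mono2)
    qed
    then have "\<forall>x\<in>?G. card ?G + c \<le> k * x"
      unfolding card using F(1) by (simp add: slack_sets_def)
    moreover have "\<forall>x\<in>F - {Suc n}. 1 \<le> x \<and> x \<le> n"
      using slack_sets_other_element(1,2)[OF F(1)] by blast
    then have "?G \<subseteq> {1..n}" using n by auto
    ultimately show "?G \<in> slack_sets k c n"
      unfolding slack_sets_def by blast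
  qed
  show "(\<lambda>G. insert (Suc n) (G - {n})) ` slack_sets k c n \<subseteq> {F \<in> slack_sets k c (Suc n). n \<notin> F}"
  proof (clarify)
    fix G assume G: "G \<in> slack_sets k c n"
    then have G': "G \<subseteq> {1..n}" "n \<in> G" "\<forall>x\<in>G. card G + c \<le> k * x"
      by (auto simp: slack_sets_def)
    have "Suc n \<notin> G" using G'(1) by auto
    then have "card (insert (Suc n) (G - {n})) = Suc (card (G - {n}))"
      using slack_sets_finite[OF G] by (intro card_insert_disjoint) auto
    also have "\<dots> = card G"
      using slack_sets_finite[OF G] G'(2) by (rule card_Suc_Diff1)
    finally have card: "card (insert (Suc n) (G - {n})) = card G" .
    have "card G + c \<le> k * Suc n"
      using G'(2,3) by (auto intro: le_trans[of _ "k * n"])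
    then have "\<forall>x\<in>insert (Suc n) (G - {n}). card (insert (Suc n) (G - {n})) + c \<le> k * x"
      unfolding card using G'(3) by simp
    moreover have "insert (Suc n) (G - {n}) \<subseteq> {1..Suc n}" using G'(1) by fastforce
    ultimately show "insert (Suc n) (G - {n}) \<in> slack_sets k c (Suc n) \<and>
        n \<notin> insert (Suc n) (G - {n})"
      unfolding slack_sets_def by simp
  qed
qed

lemma card_slack_sets_Suc:
  assumes "c < n * k"
  shows "card (slack_sets k c (Suc n)) = card (slack_sets k c n) + card (slack_sets k (Suc c) n)"
proof -
  let ?A = "slack_sets k c (Suc n)"
  have "n \<ge> 1" using assms by (cases n) auto
  have "card ?A = card ({F \<in> ?A. n \<notin> F} \<union> {F \<in> ?A. n \<in> F})"
    by (rule arg_cong[where f = card]) auto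
  also have "\<dots> = card {F \<in> ?A. n \<notin> F} + card {F \<in> ?A. n \<in> F}"
    by (rule card_Un_disjoint) (auto simp: finite_slack_sets)
  finally show ?thesis
    using card_slack_sets_without_pred[OF assms] card_slack_sets_with_pred[OF \<open>n \<ge> 1\<close>] by simp
qed

text \<open>Induction on \<open>n\<close> with \<open>c\<close> arbitrary, because the recurrence
  raises the slack.\<close>

lemma card_slack_sets:
  assumes "k \<ge> 1" and "c \<le> n * k"
  shows "card (slack_sets k c (Suc n)) = schreier_seq k (n * k - c)"
  using assms(2)
proof (induction n arbitrary: c)
  case 0
  then show ?case
    using slack_sets_eq_singleton[of k c 0] assms(1) by (simp add: schreier_seq.simps)
next
  case (Suc n)
  \<comment> \<open>The cases follow the branches of the sequence at index
    \<open>Suc n * k - c\<close>: at most 1, from 2 to \<open>k\<close>, above \<open>k\<close>. For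
    \<open>k = 1\<close> the middle one is empty.\<close>
  consider "Suc n * k \<le> c + 1" | "c + 2 \<le> Suc n * k" "Suc n * k \<le> c + k"
    | "c + 2 \<le> Suc n * k" "c + k < Suc n * k" by linarith
  then show ?case
  proof cases
    case 1
    then have "Suc n * k - c \<le> 1" by linarith
    then show ?thesis
      using slack_sets_eq_singleton[OF assms(1) Suc.prems 1] assms(1)
      by (simp add: schreier_seq.simps[of k "Suc n * k - c"] del: mult_Suc)
  next
    case 2
    then have "\<not> Suc n * k - c \<le> 1" "Suc n * k - c \<le> k" by linarith+
    then show ?thesis
      using slack_sets_eq_pair[OF 2] assms(1)
      by (simp add: schreier_seq.simps[of k "Suc n * k - c"] doubleton_eq_iff del: mult_Suc)
  next
    case 3
    \<comment> \<open>An index above \<open>k\<close> leaves room for the induction hypothesis at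
      both \<open>c\<close> and \<open>Suc c\<close>.\<close>
    then have c: "Suc c \<le> n * k" by simp
    have "card (slack_sets k c (Suc (Suc n)))
        = schreier_seq k (n * k - c) + schreier_seq k (n * k - Suc c)"
      using card_slack_sets_Suc[of c "Suc n" k] Suc.IH[of c] Suc.IH[of "Suc c"] c by simp
    \<comment> \<open>Passing from \<open>Suc n\<close> to \<open>n\<close> lowers the index by
      \<open>k\<close>, and the extra slack lowers it by one more.\<close>
    also have "n * k - c = Suc n * k - c - k" by simp
    also have "n * k - Suc c = Suc n * k - c - k - 1" by simp
    finally have "card (slack_sets k c (Suc (Suc n)))
        = schreier_seq k (Suc n * k - c - k) + schreier_seq k (Suc n * k - c - k - 1)" .
    moreover have "\<not> Suc n * k - c \<le> 1" "\<not> Suc n * k - c \<le> k" using 3 by linarith+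
    ultimately show ?thesis
      using assms(1) by (simp add: schreier_seq.simps[of k "Suc n * k - c"] del: mult_Suc)
  qed
qed

text \<open>For \<open>k \<ge> 1\<close> multiplication by \<open>k\<close> is injective, so taking
  images preserves cardinalities and matches the two families one to one.\<close>

lemma schreier_count_eq_card_slack_sets:
  assumes "k \<ge> 1"
  shows "schreier_count k n = card (slack_sets k 0 n)"
proof -
  let ?f = "\<lambda>i. i * k"
  let ?S = "{F. F \<subseteq> ?f ` {1..n} \<and> schreier F \<and> n * k \<in> F}"
  have inj: "inj ?f" using assms by (auto intro!: injI)
  have iff: "?f ` F \<in> ?S \<longleftrightarrow> F \<in> slack_sets k 0 n" if "F \<subseteq> {1..n}" for F
  proof -
    have fin: "finite F" using that finite_subset by blast
    have card: "card (?f ` F) = card F"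
      using inj by (intro card_image) (auto intro: inj_on_subset)
    show ?thesis
    proof (cases "n \<in> F")
      case True
      then have "F \<noteq> {}" "n * k \<in> ?f ` F" by blast+
      \<comment> \<open>For a finite nonempty image, the bound on \<open>Min\<close> is the bound
        \<open>card F \<le> k * x\<close> at every \<open>x\<close> in \<open>F\<close>, with slack
        0.\<close>
      with True that fin show ?thesis
        by (simp add: schreier_def slack_sets_def card image_mono mult.commute[of k])
    next
      case False
      then show ?thesis
        using assms by (auto simp: slack_sets_def)
    qed
  qed
  have "?S = (`) ?f ` slack_sets k 0 n"
  proof (intro equalityI subsetI)
    fix G assume G: "G \<in> ?S"
    then obtain F where "F \<subseteq> {1..n}" "G = ?f ` F" by (auto simp: subset_image_iff)
    then show "G \<in> (`) ?f ` slack_sets k 0 n" using iff G by blast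
  next
    fix G assume "G \<in> (`) ?f ` slack_sets k 0 n"
    then obtain F where F: "F \<in> slack_sets k 0 n" "G = ?f ` F" by blast
    then have "F \<subseteq> {1..n}" by (auto simp: slack_sets_def)
    then show "G \<in> ?S" using iff F by blast
  qed
  moreover have "inj_on ((`) ?f) (slack_sets k 0 n)"
    using inj_image_eq_iff[OF inj] by (auto intro: inj_onI)
  ultimately show ?thesis by (simp add: schreier_count_def card_image)
qed

theorem theorem1p1:
  fixes k n :: nat
  assumes "k \<ge> 1" and "n \<ge> 1"
  shows "schreier_count k n = schreier_seq k ((n - 1) * k)"
  using schreier_count_eq_card_slack_sets[OF assms(1), of n] card_slack_sets[OF assms(1), of 0 "n - 1"]
    assms(2) by simp

end
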